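(* For each integer $t\ge 1$ let $S_{\mathrm c}(t)$ be the number of $3\times 3$ semimagic squares all of whose entries are strictly between $0$ and $t$. Then $$\sum_{t>0} S_{\mathrm c}(t)\,x^t=\frac{72x^{10}\left[18x^9+46x^8+69x^7+74x^6+65x^5+46x^4+26x^3+11x^2+4x+1\right]}{(1-x^2)^2(1-x^3)^2(1-x^4)(1-x^5)}.$$ Moreover, for every integer $t\ge1$, $$S_{\mathrm c}(t)=\begin{cases}\frac{3}{10}t^5-\frac{75}{8}t^4+\frac{331}{3}t^3-\frac{5989}{10}t^2+c_1(t)\,t-c_0(t), & t \text{ even},\\[3pt] \frac{3}{10}t^5-\frac{75}{8}t^4+\frac{331}{3}t^3-\frac{11933}{20}t^2+c_1(t)\,t-c_0(t), & t\text{ odd},\end{cases}$$ where $c_1(t)=1464$ if $t\equiv 0,2$; $1456$ if $t\equiv 4$; $\frac{2831}{2}$ if $t\equiv 1$; $\frac{2847}{2}$ if $t\equiv 3,5 \pmod 6$; and $c_0(t)$ depends only on $t$ modulo $60$ and is given as follows, where in the line for $r$ the five numbers are the values of $c_0$ at $t\equiv r,\ r+12,\ r+24,\ r+36,\ r+48 \pmod{60}$, in this order: $r=0$: $1296,\ 1296,\ \frac{6624}{5},\ \frac{6192}{5},\ \frac{6624}{5}$; $r=1$: $\frac{110413}{120},\ \frac{120781}{120},\ \frac{23465}{24},\ \frac{23465}{24},\ \frac{120781}{120}$; $r=2$: $\frac{3824}{3},\ \frac{19552}{15},\ \frac{18256}{15},\ \frac{19552}{15},\ \frac{3824}{3}$;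 $r=3$: $\frac{47727}{40},\ \frac{9315}{8},\ \frac{9315}{8},\ \frac{47727}{40},\ \frac{44271}{40}$; $r=4$: $\frac{18152}{15},\ \frac{16856}{15},\ \frac{18152}{15},\ \frac{3544}{3},\ \frac{3544}{3}$; $r=5$: $\frac{25705}{24},\ \frac{25705}{24},\ \frac{131981}{120},\ \frac{121613}{120},\ \frac{131981}{120}$; $r=6$: $\frac{6192}{5},\ \frac{6624}{5},\ 1296,\ 1296,\ \frac{6624}{5}$; $r=7$: $\frac{25193}{24},\ \frac{129421}{120},\ \frac{119053}{120},\ \frac{129421}{120},\ \frac{25193}{24}$; $r=8$: $\frac{19552}{15},\ \frac{3824}{3},\ \frac{3824}{3},\ \frac{19552}{15},\ \frac{18256}{15}$; $r=9$: $\frac{44847}{40},\ \frac{41391}{40},\ \frac{44847}{40},\ \frac{8739}{8},\ \frac{8739}{8}$; $r=10$: $\frac{3544}{3},\ \frac{3544}{3},\ \frac{18152}{15},\ \frac{16856}{15},\ \frac{18152}{15}$; $r=11$: $\frac{130253}{120},\ \frac{140621}{120},\ \frac{27433}{24},\ \frac{27433}{24},\ \frac{140621}{120}$. The quasipolynomial $S_{\mathrm c}$ has period exactly $60$, and its principal constituent is $\frac{3}{10}t^5-\frac{75}{8}t^4+\frac{331}{3}t^3-\frac{5989}{10}t^2+1464t-1296$.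
   Context: A $3\times3$ semimagic square (in the strong sense) is a $3\times 3$ matrix of pairwise distinct positive integers in which all three row sums and all three column sums are equal. Squares are counted as matrices (not up to symmetry). A function $N$ of $t\in\mathbb Z_{>0}$ is a quasipolynomial if there are a positive integer $p$ and polynomials $N_0,\dots,N_{p-1}$ (the constituents) with $N(t)=N_{t \bmod p}(t)$; the minimal such $p$ is the period, and $N_0$ is the principal constituent. *)

theory Defs
  imports
    "HOL-Analysis.Analysis"
    "HOL-Computational_Algebra.Formal_Power_Series"
begin

definition semimagic :: "int ^ 3 ^ 3 \<Rightarrow> bool" where
  "semimagic M \<longleftrightarrow>
     (\<forall>i j. 0 < M $ i $ j) \<and>
     inj (\<lambda>(i, j). M $ i $ j) \<and>
     (\<exists>s. (\<forall>i. (\<Sum>j\<in>UNIV. M $ i $ j) = s) \<and> (\<forall>j. (\<Sum>i\<in>UNIV. M $ i $ j) = s))"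

definition S_c :: "nat \<Rightarrow> nat" where
  "S_c t = card {M. semimagic M \<and> (\<forall>i j. 0 < M $ i $ j \<and> M $ i $ j < int t)}"

(* A function on the positive integers is represented by a function on nat
   whose value at 0 is never used. Only the constituents with index below p matter. *)
definition has_constituents ::
    "(nat \<Rightarrow> 'a::comm_semiring_1) \<Rightarrow> nat \<Rightarrow> (nat \<Rightarrow> 'a poly) \<Rightarrow> bool" where
  "has_constituents N p C \<longleftrightarrow> p > 0 \<and> (\<forall>t>0. N t = poly (C (t mod p)) (of_nat t))"

definition quasipolynomial :: "(nat \<Rightarrow> 'a::comm_semiring_1) \<Rightarrow> bool" where
  "quasipolynomial N \<longleftrightarrow> (\<exists>p C. has_constituents N p C)"

definition quasi_period :: "(nat \<Rightarrow> 'a::comm_semiring_1) \<Rightarrow> nat" where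
  "quasi_period N = (LEAST p. \<exists>C. has_constituents N p C)"

(* Over a field of characteristic 0 the constituents for a given p are determined by N,
   since a polynomial is determined by its values on an infinite residue class. *)
definition principal_constituent :: "(nat \<Rightarrow> 'a::comm_semiring_1) \<Rightarrow> 'a poly" where
  "principal_constituent N = (THE q. \<exists>C. has_constituents N (quasi_period N) C \<and> q = C 0)"

definition c1 :: "nat \<Rightarrow> real" where
  "c1 t =
     (if t mod 6 = 0 \<or> t mod 6 = 2 then 1464
      else if t mod 6 = 4 then 1456
      else if t mod 6 = 1 then 2831/2
      else 2847/2)"

definition c0_table :: "real list list" where
  "c0_table =
    [[1296, 1296, 6624/5, 6192/5, 6624/5],
     [110413/120, 120781/120, 23465/24, 23465/24, 120781/120],
     [3824/3, 19552/15, 18256/15, 19552/15, 3824/3],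
     [47727/40, 9315/8, 9315/8, 47727/40, 44271/40],
     [18152/15, 16856/15, 18152/15, 3544/3, 3544/3],
     [25705/24, 25705/24, 131981/120, 121613/120, 131981/120],
     [6192/5, 6624/5, 1296, 1296, 6624/5],
     [25193/24, 129421/120, 119053/120, 129421/120, 25193/24],
     [19552/15, 3824/3, 3824/3, 19552/15, 18256/15],
     [44847/40, 41391/40, 44847/40, 8739/8, 8739/8],
     [3544/3, 3544/3, 18152/15, 16856/15, 18152/15],
     [130253/120, 140621/120, 27433/24, 27433/24, 140621/120]]"

(* Row r, column k (both counted from 0) holds the value for t congruent to
   r + 12 k modulo 60. *)
definition c0 :: "nat \<Rightarrow> real" where
  "c0 t = c0_table ! (t mod 12) ! (t mod 60 div 12)"

end

(* Index rows and columns by residues modulo 3. The semimagic squares are exactly the matrices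
   M_ij = c + x_(i+j) + y_(i-j), i.e. rearranged addition tables, since the even and the odd
   permutation matrices are the level sets of i - j and of i + j. Normalising min x = min y = 0 makes
   (c, x, y) unique, and sorting x and y leaves gaps (p, q) and (r, s); the entries are distinct iff
   {p, q, p + q} and {r, s, r + s} are disjoint. Hence S_c(t) = 36 * #{(c, u, p, q, r, s) positive,
   gaps disjoint, c + u + p + q + r + s = t}. By symmetry let p + q < e = r + s and count the values
   of r: with X = {p, q, p + q} exactly those in X and in e - X are excluded, and all coincidences
   within the union of X and e - X are linear conditions on (p, q, e), so that every term of the
   generating function is a product of geometric series. *)
theory Submission
  imports Defs
begin

section \<open>Generating functions of weighted sets\<close>

definition gen_fun :: "'a set \<Rightarrow> ('a \<Rightarrow> nat) \<Rightarrow> ('a \<Rightarrow> real) \<Rightarrow> real fps" where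
  "gen_fun S s w = Abs_fps (\<lambda>n. \<Sum>x | x \<in> S \<and> s x = n. w x)"

text \<open>A sum over an infinite set takes the default value 0, so \<open>gen_fun\<close> counts
  what it should only under this condition.\<close>

definition fin_fibres :: "'a set \<Rightarrow> ('a \<Rightarrow> nat) \<Rightarrow> bool" where
  "fin_fibres S s \<longleftrightarrow> (\<forall>n. finite {x \<in> S. s x = n})"

lemma gen_fun_nth: "fps_nth (gen_fun S s w) n = (\<Sum>x | x \<in> S \<and> s x = n. w x)"
  by (simp add: gen_fun_def)

lemma gen_fun_add: "gen_fun S s (\<lambda>x. v x + w x) = gen_fun S s v + gen_fun S s w"
  by (rule fps_ext) (simp add: gen_fun_nth sum.distrib)

lemma gen_fun_cmult: "gen_fun S s (\<lambda>x. c * w x) = fps_const c * gen_fun S s w"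
  by (rule fps_ext) (simp add: gen_fun_nth sum_distrib_left)

lemma gen_fun_cong:
  assumes "\<And>x. x \<in> S \<Longrightarrow> s x = r x" "\<And>x. x \<in> S \<Longrightarrow> v x = w x"
  shows "gen_fun S s v = gen_fun S r w"
proof -
  have "{x \<in> S. s x = n} = {x \<in> S. r x = n}" for n using assms by auto
  then show ?thesis using assms by (auto simp: fps_eq_iff gen_fun_nth intro!: sum.cong)
qed

lemma gen_fun_restrict:
  assumes "fin_fibres S s"
  shows "gen_fun S s (\<lambda>x. if P x then w x else 0) = gen_fun {x \<in> S. P x} s w"
proof (rule fps_ext)
  fix n
  show "fps_nth (gen_fun S s (\<lambda>x. if P x then w x else 0)) n = fps_nth (gen_fun {x \<in> S. P x} s w) n"
    unfolding gen_fun_nth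
    by (rule sum.mono_neutral_cong_right) (use assms in \<open>auto simp: fin_fibres_def\<close>)
qed

lemma gen_fun_Un:
  assumes "fin_fibres S s" "fin_fibres T s" "S \<inter> T = {}"
  shows "gen_fun (S \<union> T) s w = gen_fun S s w + gen_fun T s w"
proof (rule fps_ext)
  fix n
  have "{x \<in> S \<union> T. s x = n} = {x \<in> S. s x = n} \<union> {x \<in> T. s x = n}" by auto
  then show "fps_nth (gen_fun (S \<union> T) s w) n = fps_nth (gen_fun S s w + gen_fun T s w) n"
    using assms by (simp add: gen_fun_nth fin_fibres_def) (subst sum.union_disjoint, auto)
qed

lemma gen_fun_reindex:
  assumes "bij_betw h S T" "\<And>x. x \<in> S \<Longrightarrow> r (h x) = s x" "\<And>x. x \<in> S \<Longrightarrow> w (h x) = v x"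
  shows "gen_fun S s v = gen_fun T r w"
proof (rule fps_ext)
  fix n
  have "bij_betw h {x \<in> S. s x = n} {y \<in> T. r y = n}"
    using assms(1,2) by (force simp: bij_betw_def inj_on_def)
  then have "(\<Sum>x | x \<in> S \<and> s x = n. w (h x)) = fps_nth (gen_fun T r w) n"
    unfolding gen_fun_nth by (rule sum.reindex_bij_betw)
  then show "fps_nth (gen_fun S s v) n = fps_nth (gen_fun T r w) n"
    unfolding gen_fun_nth using assms(3) by simp
qed

lemma fin_fibres_subset: "fin_fibres T s \<Longrightarrow> S \<subseteq> T \<Longrightarrow> fin_fibres S s"
  by (auto simp: fin_fibres_def elim!: rev_finite_subset)

lemma fin_fibres_mult:
  fixes a :: nat
  assumes "a > 0"
  shows "fin_fibres S ((*) a)"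
  unfolding fin_fibres_def
proof
  fix n
  have "{x \<in> S. a * x = n} \<subseteq> {..n}" using assms by auto
  then show "finite {x \<in> S. a * x = n}" by (rule finite_subset) simp
qed

text \<open>Splitting \<open>n\<close> as \<open>i + (n - i)\<close> cuts a fibre of the product
  into finitely many disjoint boxes; this yields both its finiteness and the Cauchy product.\<close>

lemma fibre_Times:
  "{z \<in> S \<times> T. (case z of (x, y) \<Rightarrow> s x + r y) = (n::nat)} =
    (\<Union>i\<in>{..n}. {x \<in> S. s x = i} \<times> {y \<in> T. r y = n - i})"
  by auto

lemma fin_fibres_Times:
  assumes "fin_fibres S s" "fin_fibres T r"
  shows "fin_fibres (S \<times> T) (\<lambda>(x, y). s x + r y)"
  unfolding fin_fibres_def fibre_Times using assms by (auto simp: fin_fibres_def)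

lemma gen_fun_times:
  assumes "fin_fibres S s" "fin_fibres T r"
  shows "gen_fun S s v * gen_fun T r w =
    gen_fun (S \<times> T) (\<lambda>(x, y). s x + r y) (\<lambda>(x, y). v x * w y)"
proof (rule fps_ext)
  fix n
  have "fps_nth (gen_fun (S \<times> T) (\<lambda>(x, y). s x + r y) (\<lambda>(x, y). v x * w y)) n =
      (\<Sum>i\<in>{..n}. \<Sum>(x, y) \<in> {x \<in> S. s x = i} \<times> {y \<in> T. r y = n - i}. v x * w y)"
    unfolding gen_fun_nth fibre_Times using assms
    by (subst sum.UNION_disjoint) (auto simp: fin_fibres_def)
  also have "\<dots> = fps_nth (gen_fun S s v * gen_fun T r w) n"
    by (simp add: fps_mult_nth gen_fun_nth sum_product sum.cartesian_product atLeast0AtMost)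
  finally show "fps_nth (gen_fun S s v * gen_fun T r w) n =
    fps_nth (gen_fun (S \<times> T) (\<lambda>(x, y). s x + r y) (\<lambda>(x, y). v x * w y)) n" by simp
qed

text \<open>Groups the summands along a map that preserves size. It serves to sum over the second
  gap pair first, with \<open>h\<close> the map \<open>gap_profile\<close>.\<close>

lemma gen_fun_fibre:
  assumes "fin_fibres S s" "\<And>x. x \<in> S \<Longrightarrow> h x \<in> T" "\<And>x. x \<in> S \<Longrightarrow> r (h x) = s x"
    and "fin_fibres T r"
  shows "gen_fun S s v = gen_fun T r (\<lambda>y. \<Sum>x | x \<in> S \<and> h x = y. v x)"
proof (rule fps_ext)
  fix n
  have "fps_nth (gen_fun S s v) n =
     (\<Sum>y | y \<in> T \<and> r y = n. \<Sum>x | x \<in> {x \<in> S. s x = n} \<and> h x = y. v x)"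
    unfolding gen_fun_nth
    by (rule sum.group[symmetric]) (use assms in \<open>auto simp: fin_fibres_def\<close>)
  also have "\<dots> = fps_nth (gen_fun T r (\<lambda>y. \<Sum>x | x \<in> S \<and> h x = y. v x)) n"
    unfolding gen_fun_nth using assms(3)
    by (intro sum.cong refl) auto
  finally show "fps_nth (gen_fun S s v) n = fps_nth (gen_fun T r (\<lambda>y. \<Sum>x | x \<in> S \<and> h x = y. v x)) n" .
qed

section \<open>Geometric series without constant term\<close>

definition geo :: "nat \<Rightarrow> real fps" where
  "geo a = gen_fun {0<..} ((*) a) (\<lambda>_. 1)"

text \<open>With Y = X^a and \<open>a > 0\<close>, \<open>geo a\<close> is Y / (1 - Y) and
  \<open>geo_deriv a\<close> is Y / (1 - Y)^2, the image of the former under Y d/dY.\<close>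

definition geo_deriv :: "nat \<Rightarrow> real fps" where
  "geo_deriv a = gen_fun {0<..} ((*) a) real"

lemma gen_fun_mult_nth:
  assumes "a > 0"
  shows "fps_nth (gen_fun {0<..} ((*) a) w) n = (if a dvd n \<and> n > 0 then w (n div a) else 0)"
proof (cases "a dvd n \<and> n > 0")
  case True
  then have "{x \<in> {0<..}. a * x = n} = {n div a}" using assms by auto
  then show ?thesis using True by (simp add: gen_fun_nth)
next
  case False
  then have e: "{x \<in> {0<..}. a * x = n} = {}" using assms by auto
  show ?thesis using False by (simp only: gen_fun_nth e) auto
qed

lemma geo_times:
  assumes "a > 0"
  shows "geo a * (1 - fps_X ^ a) = fps_X ^ a"
proof (rule fps_ext)
  fix n
  \<comment> \<open>The case \<open>n = a\<close> stands apart: the summation starts at 1, so the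
    coefficient at \<open>n - a = 0\<close> is 0 although \<open>a\<close> divides 0.\<close>
  consider "n < a" | "n = a" | "n > a" by linarith
  then show "fps_nth (geo a * (1 - fps_X ^ a)) n = fps_nth (fps_X ^ a) n"
    using assms
    by cases (auto simp: geo_def right_diff_distrib fps_X_power_mult_right_nth gen_fun_mult_nth
        dvd_minus_self dest: dvd_imp_le)
qed

lemma geo_deriv_times:
  assumes "a > 0"
  shows "geo_deriv a * (1 - fps_X ^ a) = geo a"
proof (rule fps_ext)
  fix n
  consider "n < a" | "n = a" | "n > a" by linarith
  then show "fps_nth (geo_deriv a * (1 - fps_X ^ a)) n = fps_nth (geo a) n"
    using assms
    by cases (auto simp: geo_def geo_deriv_def right_diff_distrib fps_X_power_mult_right_nth
        gen_fun_mult_nth dvd_minus_self le_div_geq dest: dvd_imp_le)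
qed

section \<open>Semimagic squares as addition tables\<close>

(* Entry (i, j), with indices from 0 and modulo 3, is c + x_(i+j) + y_(i-j). *)
definition table :: "nat \<Rightarrow> nat \<times> nat \<times> nat \<Rightarrow> nat \<times> nat \<times> nat \<Rightarrow> int ^ 3 ^ 3" where
  "table c = (\<lambda>(x0, x1, x2) (y0, y1, y2). vector
     [vector [int (c + x0 + y0), int (c + x1 + y2), int (c + x2 + y1)],
      vector [int (c + x1 + y1), int (c + x2 + y0), int (c + x0 + y2)],
      vector [int (c + x2 + y2), int (c + x0 + y1), int (c + x1 + y0)]])"

definition offsets :: "(nat \<times> nat \<times> nat) set" where
  "offsets = {(x0, x1, x2). x0 \<noteq> x1 \<and> x0 \<noteq> x2 \<and> x1 \<noteq> x2 \<and> min x0 (min x1 x2) = 0}"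

definition gaps :: "nat \<times> nat \<times> nat \<Rightarrow> int set" where
  "gaps = (\<lambda>(x0, x1, x2). {\<bar>int x0 - int x1\<bar>, \<bar>int x0 - int x2\<bar>, \<bar>int x1 - int x2\<bar>})"

definition top_offset :: "nat \<times> nat \<times> nat \<Rightarrow> nat" where
  "top_offset = (\<lambda>(x0, x1, x2). max x0 (max x1 x2))"

text \<open>For positive gaps these are the six orders of the sorted triple 0 < p < p + q.\<close>

definition arrange :: "nat \<Rightarrow> nat \<Rightarrow> nat \<Rightarrow> nat \<times> nat \<times> nat" where
  "arrange i p q =
     [(0, p, p + q), (0, p + q, p), (p, 0, p + q), (p + q, 0, p), (p, p + q, 0), (p + q, p, 0)] ! i"

lemma offsets_iff:
  "(x0, x1, x2) \<in> offsets \<longleftrightarrow>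
    x0 \<noteq> x1 \<and> x0 \<noteq> x2 \<and> x1 \<noteq> x2 \<and> (x0 = 0 \<or> x1 = 0 \<or> x2 = 0)"
  by (auto simp: offsets_def min_def split: if_splits)

lemma less_6_cases:
  fixes i :: nat
  assumes "i < 6"
  obtains "i = 0" | "i = 1" | "i = 2" | "i = 3" | "i = 4" | "i = 5"
  using assms by linarith

text \<open>The place of the zero and the order of the other two entries give the index, and
  consecutive differences of the sorted triple give the gaps. Positive gaps keep the six orders
  apart.\<close>

lemma bij_betw_arrange:
  "bij_betw (\<lambda>(i, p, q). arrange i p q) ({..<6} \<times> {0<..} \<times> {0<..}) offsets"
  unfolding bij_betw_def
proof
  show "inj_on (\<lambda>(i, p, q). arrange i p q) ({..<6} \<times> {0<..} \<times> {0<..})"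
    by (auto simp: inj_on_def arrange_def elim!: less_6_cases)
  show "(\<lambda>(i, p, q). arrange i p q) ` ({..<6} \<times> {0<..} \<times> {0<..}) = offsets"
  proof
    show "(\<lambda>(i, p, q). arrange i p q) ` ({..<6} \<times> {0<..} \<times> {0<..}) \<subseteq> offsets"
      by (auto simp: arrange_def offsets_def elim!: less_6_cases)
    show "offsets \<subseteq> (\<lambda>(i, p, q). arrange i p q) ` ({..<6} \<times> {0<..} \<times> {0<..})"
    proof
      fix z assume "z \<in> offsets"
      then obtain a b c where z: "z = (a, b, c)" and d: "a \<noteq> b" "a \<noteq> c" "b \<noteq> c"
        and "a = 0 \<or> b = 0 \<or> c = 0"
        by (cases z) (auto simp: offsets_iff)
      then consider "a = 0" "b < c" | "a = 0" "c < b" | "b = 0" "a < c" | "b = 0" "c < a"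
        | "c = 0" "a < b" | "c = 0" "b < a"
        by (metis nat_neq_iff)
      then have "\<exists>i<6. \<exists>p>0. \<exists>q>0. (a, b, c) = arrange i p q"
      proof cases
        case 1 then show ?thesis using d
          by (intro exI[of _ 0] exI[of _ b] exI[of _ "c - b"] conjI) (auto simp: arrange_def)
      next
        case 2 then show ?thesis using d
          by (intro exI[of _ 1] exI[of _ c] exI[of _ "b - c"] conjI) (auto simp: arrange_def)
      next
        case 3 then show ?thesis using d
          by (intro exI[of _ 2] exI[of _ a] exI[of _ "c - a"] conjI) (auto simp: arrange_def)
      next
        case 4 then show ?thesis using d
          by (intro exI[of _ 3] exI[of _ c] exI[of _ "a - c"] conjI) (auto simp: arrange_def)
      next
        case 5 then show ?thesis using d
          by (intro exI[of _ 4] exI[of _ a] exI[of _ "b - a"] conjI) (auto simp: arrange_def)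
      next
        case 6 then show ?thesis using d
          by (intro exI[of _ 5] exI[of _ b] exI[of _ "a - b"] conjI) (auto simp: arrange_def)
      qed
      then show "z \<in> (\<lambda>(i, p, q). arrange i p q) ` ({..<6} \<times> {0<..} \<times> {0<..})"
        unfolding z by force
    qed
  qed
qed

lemma gaps_arrange: "i < 6 \<Longrightarrow> gaps (arrange i p q) = int ` {p, q, p + q}"
  by (auto simp: arrange_def gaps_def elim!: less_6_cases)

lemma top_offset_arrange: "i < 6 \<Longrightarrow> top_offset (arrange i p q) = p + q"
  by (auto simp: arrange_def top_offset_def elim!: less_6_cases)

text \<open>Entries sharing a summand determine all differences within \<open>x\<close> and within
  \<open>y\<close>; since each triple has a zero and no negative entry, the differences fix it, and
  then \<open>c\<close> is fixed too.\<close>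

lemma table_inject:
  assumes o: "(x0, x1, x2) \<in> offsets" "(y0, y1, y2) \<in> offsets"
      "(x0', x1', x2') \<in> offsets" "(y0', y1', y2') \<in> offsets"
    and e: "table c (x0, x1, x2) (y0, y1, y2) = table c' (x0', x1', x2') (y0', y1', y2')"
  shows "c = c' \<and> (x0, x1, x2) = (x0', x1', x2') \<and> (y0, y1, y2) = (y0', y1', y2')"
proof -
  from e have e': "c + x0 + y0 = c' + x0' + y0'" "c + x0 + y1 = c' + x0' + y1'"
      "c + x0 + y2 = c' + x0' + y2'" "c + x1 + y0 = c' + x1' + y0'" "c + x2 + y0 = c' + x2' + y0'"
    by (simp_all add: table_def vec_eq_iff forall_3)
  have mx: "x0 = 0 \<or> x1 = 0 \<or> x2 = 0" "x0' = 0 \<or> x1' = 0 \<or> x2' = 0"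
    and my: "y0 = 0 \<or> y1 = 0 \<or> y2 = 0" "y0' = 0 \<or> y1' = 0 \<or> y2' = 0"
    using o by (simp_all add: offsets_iff)
  have "x1 + x0' = x1' + x0" "x2 + x0' = x2' + x0" "y1 + y0' = y1' + y0" "y2 + y0' = y2' + y0"
    using e' by linarith+
  then have x: "x0 = x0'" and y: "y0 = y0'"
    using mx my by (auto intro: antisym)
  show ?thesis
    using e' x y by simp
qed

lemma inj_on_table: "inj_on (\<lambda>(c, x, y). table c x y) (UNIV \<times> offsets \<times> offsets)"
  by (rule inj_onI, clarify) (blast dest: table_inject)

text \<open>Every row and column contains each of the three \<open>x\<close> and each of the three
  \<open>y\<close> once, so the line sums agree. All nine pairs occur, so the extreme entries are
  \<open>c\<close> and \<open>c\<close> plus both top offsets. Two entries sharing a summand differ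
  anyway; a collision of two others says that a difference in \<open>x\<close> equals one in
  \<open>y\<close>, and the sign is absorbed because all pairs occur.\<close>

lemma semimagic_table_iff:
  assumes "x \<in> offsets" "y \<in> offsets"
  shows "semimagic (table c x y) \<and> (\<forall>i j. 0 < table c x y $ i $ j \<and> table c x y $ i $ j < int t)
    \<longleftrightarrow> 0 < c \<and> c + top_offset x + top_offset y < t \<and> gaps x \<inter> gaps y = {}"
proof -
  obtain x0 x1 x2 y0 y1 y2 where xy: "x = (x0, x1, x2)" "y = (y0, y1, y2)"
    by (metis prod_cases3)
  have dx: "x0 \<noteq> x1" "x0 \<noteq> x2" "x1 \<noteq> x2" "y0 \<noteq> y1" "y0 \<noteq> y2" "y1 \<noteq> y2"
    and mx: "x0 = 0 \<or> x1 = 0 \<or> x2 = 0" and my: "y0 = 0 \<or> y1 = 0 \<or> y2 = 0"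
    using assms by (simp_all add: xy offsets_iff)
  have sums: "\<exists>s. (\<forall>i. (\<Sum>j\<in>UNIV. table c x y $ i $ j) = s) \<and> (\<forall>j. (\<Sum>i\<in>UNIV. table c x y $ i $ j) = s)"
    by (rule exI[of _ "int (3 * c + x0 + x1 + x2 + y0 + y1 + y2)"])
       (simp add: xy table_def forall_3 sum_3)
  have pos: "(\<forall>i j. 0 < table c x y $ i $ j) \<longleftrightarrow> 0 < c"
    using mx my by (auto simp: xy table_def forall_3)
  have below: "(\<forall>i j. table c x y $ i $ j < int t) \<longleftrightarrow> c + top_offset x + top_offset y < t"
    by (simp add: xy table_def forall_3 top_offset_def) linarith
  have inj: "inj (\<lambda>(i, j). table c x y $ i $ j) \<longleftrightarrow> gaps x \<inter> gaps y = {}"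
  proof -
    have gap: "\<bar>int a - int b\<bar> = \<bar>int d - int e\<bar> \<longleftrightarrow> int a + int e = int b + int d \<or> int a + int d = int b + int e"
      for a b d e by linarith
    have "inj (\<lambda>(i, j). table c x y $ i $ j) \<longleftrightarrow>
        distinct (map int [x0 + y0, x1 + y2, x2 + y1, x1 + y1, x2 + y0, x0 + y2, x2 + y2, x0 + y1, x1 + y0])"
      unfolding inj_def split_paired_All forall_3 xy table_def by auto
    also have "\<dots> \<longleftrightarrow> gaps x \<inter> gaps y = {}"
      unfolding xy gaps_def prod.case using dx by (auto simp: gap add.commute)
    finally show ?thesis .
  qed
  show ?thesis
    using sums pos below inj unfolding semimagic_def by blast
qed

lemma semimagic_imp_table:
  assumes "semimagic M"
  shows "\<exists>c. \<exists>x\<in>offsets. \<exists>y\<in>offsets. M = table c x y"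
proof -
  obtain s where s: "\<forall>i. (\<Sum>j\<in>UNIV. M $ i $ j) = s" "\<forall>j. (\<Sum>i\<in>UNIV. M $ i $ j) = s"
    and pos: "\<forall>i j. 0 < M $ i $ j" and inj: "inj (\<lambda>(i, j). M $ i $ j)"
    using assms by (auto simp: semimagic_def)
  have neq: "M $ i $ j \<noteq> M $ i' $ j'" if "(i, j) \<noteq> (i', j')" for i j i' j'
    using injD[OF inj, of "(i, j)" "(i', j')"] that by auto
  \<comment> \<open>The diagonal cells share the summand \<open>y0\<close>, and the cells (1,1),
    (3,2), (2,3) share \<open>x0\<close>. Hence \<open>u\<close> must be \<open>c + y0\<close>,
    \<open>v\<close> must be \<open>c + x0\<close>, and \<open>c\<close> is recovered as
    \<open>u + v\<close> minus the entry at (1,1).\<close>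
  define u where "u = min (M$1$1) (min (M$3$3) (M$2$2))"
  define v where "v = min (M$1$1) (min (M$3$2) (M$2$3))"
  have uv: "u \<in> {M$1$1, M$3$3, M$2$2}" "v \<in> {M$1$1, M$3$2, M$2$3}"
    "u \<le> M$1$1" "u \<le> M$3$3" "u \<le> M$2$2" "v \<le> M$1$1" "v \<le> M$3$2" "v \<le> M$2$3"
    by (auto simp: u_def v_def min_def)
  define x where "x = (nat (M$1$1 - u), nat (M$3$3 - u), nat (M$2$2 - u))"
  define y where "y = (nat (M$1$1 - v), nat (M$3$2 - v), nat (M$2$3 - v))"
  define c where "c = nat (u + v - M$1$1)"
  note eqs = s[unfolded forall_3 sum_3]
  \<comment> \<open>Wherever the two minima are attained, the equal line sums show that this number
    is itself an entry of \<open>M\<close>.\<close>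
  have c: "u + v - M$1$1 > 0"
    using uv eqs pos[unfolded forall_3] by auto
  have "x \<in> offsets"
    unfolding x_def offsets_iff
    by (use uv neq[of 1 1 3 3] neq[of 1 1 2 2] neq[of 3 3 2 2] in auto)
  moreover have "y \<in> offsets"
    unfolding y_def offsets_iff
    by (use uv neq[of 1 1 3 2] neq[of 1 1 2 3] neq[of 3 2 2 3] in auto)
  moreover have "M = table c x y"
  proof -
    have nn: "int (nat (M$1$1 - u)) = M$1$1 - u" "int (nat (M$3$3 - u)) = M$3$3 - u"
      "int (nat (M$2$2 - u)) = M$2$2 - u" "int (nat (M$1$1 - v)) = M$1$1 - v"
      "int (nat (M$3$2 - v)) = M$3$2 - v" "int (nat (M$2$3 - v)) = M$2$3 - v"
      "int c = u + v - M$1$1"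
      using uv c by (simp_all add: c_def)
    show ?thesis
      using eqs
      by (simp add: vec_eq_iff forall_3 table_def x_def y_def nn del: int_nat_eq)
  qed
  ultimately show ?thesis by blast
qed

section \<open>From squares to pairs of disjoint gap sets\<close>

abbreviation pos :: "nat set" where "pos \<equiv> {0<..}"

definition disjoint_gaps :: "((nat \<times> nat) \<times> nat \<times> nat) set" where
  "disjoint_gaps = {((p, q), r, s). 0 < p \<and> 0 < q \<and> 0 < r \<and> 0 < s \<and> {p, q, p + q} \<inter> {r, s, r + s} = {}}"

lemma disjoint_gaps_iff:
  "((p, q), r, s) \<in> disjoint_gaps \<longleftrightarrow> 0 < p \<and> 0 < q \<and> 0 < r \<and> 0 < s \<and>
    r \<noteq> p \<and> r \<noteq> q \<and> r \<noteq> p + q \<and> s \<noteq> p \<and> s \<noteq> q \<and> s \<noteq> p + q \<and>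
    r + s \<noteq> p \<and> r + s \<noteq> q \<and> r + s \<noteq> p + q"
  by (simp add: disjoint_gaps_def)

definition quad_sum :: "(nat \<times> nat) \<times> nat \<times> nat \<Rightarrow> nat" where
  "quad_sum = (\<lambda>((p, q), r, s). p + q + r + s)"

lemma fin_fibres_plus: "fin_fibres (pos \<times> pos) (\<lambda>(x, y). x + y)"
  using fin_fibres_Times[OF fin_fibres_mult[of 1 pos] fin_fibres_mult[of 1 pos]] by simp

lemma fin_fibres_disjoint_gaps: "fin_fibres disjoint_gaps quad_sum"
proof (rule fin_fibres_subset)
  show "disjoint_gaps \<subseteq> (pos \<times> pos) \<times> pos \<times> pos" by (auto simp: disjoint_gaps_def)
  have "quad_sum = (\<lambda>(x, y). (case x of (a, b) \<Rightarrow> a + b) + (case y of (a, b) \<Rightarrow> a + b))"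
    by (auto simp: quad_sum_def)
  then show "fin_fibres ((pos \<times> pos) \<times> pos \<times> pos) quad_sum"
    using fin_fibres_Times[OF fin_fibres_plus fin_fibres_plus] by simp
qed

definition parts_sum :: "(nat \<times> nat) \<times> (nat \<times> nat) \<times> (nat \<times> nat) \<times> nat \<times> nat \<Rightarrow> nat" where
  "parts_sum = (\<lambda>(_, (c, u), g). c + u + quad_sum g)"

text \<open>The first pair holds the orders of the two triples, \<open>c\<close> is the smallest
  entry of the square, and the slack \<open>u\<close> is the distance from its largest entry up to
  \<open>t\<close>; the strict bound on the entries makes \<open>u\<close> positive.\<close>

definition decompositions :: "nat \<Rightarrow> ((nat \<times> nat) \<times> (nat \<times> nat) \<times> (nat \<times> nat) \<times> nat \<times> nat) set" where
  "decompositions t =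
    {z \<in> ({..<6} \<times> {..<6}) \<times> (pos \<times> pos) \<times> disjoint_gaps. parts_sum z = t}"

text \<open>The table determines \<open>c\<close> and both triples, hence orders and gaps. The slack
  \<open>u\<close> does not enter the table, but the prescribed total \<open>t\<close> recovers
  it.\<close>

lemma bij_betw_semimagic:
  "bij_betw (\<lambda>((i, j), (c, u), (p, q), r, s). table c (arrange i p q) (arrange j r s))
    (decompositions t)
    {M. semimagic M \<and> (\<forall>i j. 0 < M $ i $ j \<and> M $ i $ j < int t)}"
    (is "bij_betw ?f _ ?B")
proof -
  have arr: "arrange i p q \<in> offsets" if "i < 6" "0 < p" "0 < q" for i p q
    using bij_betwE[OF bij_betw_arrange] that by fastforce
  have arr_inj: "i = i' \<and> p = p' \<and> q = q'"
    if "arrange i p q = arrange i' p' q'" "i < 6" "0 < p" "0 < q" "i' < 6" "0 < p'" "0 < q'"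
    for i p q i' p' q'
    using inj_onD[OF bij_betw_imp_inj_on[OF bij_betw_arrange], of "(i, p, q)" "(i', p', q')"] that
    by auto
  have inj: "inj_on ?f (decompositions t)"
  proof (rule inj_onI)
    fix z z'
    assume z: "z \<in> decompositions t" "z' \<in> decompositions t" and "?f z = ?f z'"
    moreover obtain i j c u p q r s where z1: "z = ((i, j), (c, u), (p, q), r, s)"
      by (metis surj_pair)
    moreover obtain i' j' c' u' p' q' r' s' where z2: "z' = ((i', j'), (c', u'), (p', q'), r', s')"
      by (metis surj_pair)
    ultimately have eq: "table c (arrange i p q) (arrange j r s) =
        table c' (arrange i' p' q') (arrange j' r' s')"
      by simp
    have lt: "i < 6" "j < 6" "i' < 6" "j' < 6" "0 < p" "0 < q" "0 < r" "0 < s"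
        "0 < p'" "0 < q'" "0 < r'" "0 < s'"
      and sum: "c + u + (p + q + r + s) = t" "c' + u' + (p' + q' + r' + s') = t"
      using z by (auto simp: z1 z2 decompositions_def parts_sum_def disjoint_gaps_def quad_sum_def)
    have e: "c = c'" "arrange i p q = arrange i' p' q'" "arrange j r s = arrange j' r' s'"
      using inj_onD[OF inj_on_table, of "(c, arrange i p q, arrange j r s)"
          "(c', arrange i' p' q', arrange j' r' s')"] eq lt arr by auto
    have "i = i' \<and> p = p' \<and> q = q'" "j = j' \<and> r = r' \<and> s = s'"
      using arr_inj[OF e(2)] arr_inj[OF e(3)] lt by auto
    then show "z = z'"
      using sum e(1) by (simp add: z1 z2)
  qed
  have gaps_iff: "gaps (arrange i p q) \<inter> gaps (arrange j r s) = {} \<longleftrightarrow> {p, q, p + q} \<inter> {r, s, r + s} = {}"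
    if "i < 6" "j < 6" for i j p q r s
    using that by (simp only: gaps_arrange image_Int[OF inj_of_nat, symmetric] image_is_empty)
  have "?f ` decompositions t = ?B"
  proof
    show "?f ` decompositions t \<subseteq> ?B"
    proof clarify
      fix i j c u p q r s
      assume "((i, j), (c, u), (p, q), r, s) \<in> decompositions t"
      then have lt: "i < 6" "j < 6" "0 < c" "0 < u" "0 < p" "0 < q" "0 < r" "0 < s"
        and sum: "c + u + (p + q + r + s) = t" and dj: "{p, q, p + q} \<inter> {r, s, r + s} = {}"
        unfolding decompositions_def parts_sum_def disjoint_gaps_def quad_sum_def by auto
      show "semimagic (table c (arrange i p q) (arrange j r s)) \<and>
        (\<forall>i' j'. 0 < table c (arrange i p q) (arrange j r s) $ i' $ j' \<and>
          table c (arrange i p q) (arrange j r s) $ i' $ j' < int t)"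
        using lt sum dj
        by (simp only: semimagic_table_iff[OF arr arr] gaps_iff top_offset_arrange) simp
    qed
    show "?B \<subseteq> ?f ` decompositions t"
    proof clarify
      fix M assume M: "semimagic M" "\<forall>i j. 0 < M $ i $ j \<and> M $ i $ j < int t"
      obtain c x y where xy: "x \<in> offsets" "y \<in> offsets" and T: "M = table c x y"
        using semimagic_imp_table[OF M(1)] by blast
      obtain i p q where x: "x = arrange i p q" "i < 6" "0 < p" "0 < q"
        using xy(1) bij_betw_imp_surj_on[OF bij_betw_arrange] by fastforce
      obtain j r s where y: "y = arrange j r s" "j < 6" "0 < r" "0 < s"
        using xy(2) bij_betw_imp_surj_on[OF bij_betw_arrange] by fastforce
      have "0 < c \<and> c + top_offset x + top_offset y < t \<and> gaps x \<inter> gaps y = {}"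
        using M semimagic_table_iff[OF xy, of c t] unfolding T by blast
      then have c: "0 < c" "c + (p + q) + (r + s) < t" and dj: "{p, q, p + q} \<inter> {r, s, r + s} = {}"
        by (simp_all only: x(1) y(1) top_offset_arrange[OF x(2)] top_offset_arrange[OF y(2)]
            gaps_iff[OF x(2) y(2)])
      have "((i, j), (c, t - (c + (p + q) + (r + s))), (p, q), r, s) \<in> decompositions t"
      proof -
        have "((p, q), r, s) \<in> disjoint_gaps"
          using dj x(3,4) y(3,4) by (simp add: disjoint_gaps_def)
        then show ?thesis
          using c x(2) y(2) by (simp add: decompositions_def parts_sum_def quad_sum_def)
      qed
      then show "M \<in> ?f ` decompositions t"
        unfolding T x y by (rule rev_image_eqI) simp
    qed
  qed
  with inj show ?thesis by (simp add: bij_betw_def)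
qed

text \<open>The 6 * 6 orders have size 0 and contribute the constant 36; \<open>c\<close> and
  \<open>u\<close> are free positive integers and contribute one factor \<open>geo 1\<close>
  each.\<close>

lemma fps_S_c: "Abs_fps (\<lambda>t. real (S_c t)) = 36 * (geo 1 * geo 1 * gen_fun disjoint_gaps quad_sum (\<lambda>_. 1))"
proof -
  let ?I = "{..<6::nat} \<times> {..<6::nat}"
  have fI: "fin_fibres ?I (\<lambda>_. 0)" by (simp add: fin_fibres_def)
  have gI: "gen_fun ?I (\<lambda>_. 0) (\<lambda>_. 1) = 36"
    by (rule fps_ext) (simp add: gen_fun_nth numeral_fps_const)
  have geo2: "geo 1 * geo 1 = gen_fun (pos \<times> pos) (\<lambda>(x, y). x + y) (\<lambda>_. 1)"
    unfolding geo_def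
    by (subst gen_fun_times) (auto intro!: fin_fibres_mult gen_fun_cong)
  have fPg: "fin_fibres ((pos \<times> pos) \<times> disjoint_gaps) (\<lambda>(x, y). (case x of (a, b) \<Rightarrow> a + b) + quad_sum y)"
    by (rule fin_fibres_Times[OF fin_fibres_plus fin_fibres_disjoint_gaps])
  have "36 * (geo 1 * geo 1 * gen_fun disjoint_gaps quad_sum (\<lambda>_. 1)) =
     gen_fun (?I \<times> (pos \<times> pos) \<times> disjoint_gaps) parts_sum (\<lambda>_. 1)"
    unfolding geo2 gI[symmetric]
    by (subst gen_fun_times[OF fin_fibres_plus fin_fibres_disjoint_gaps], subst gen_fun_times[OF fI fPg])
       (auto simp: parts_sum_def intro!: gen_fun_cong)
  moreover have "S_c t = card (decompositions t)" for t
    unfolding S_c_def by (rule bij_betw_same_card[OF bij_betw_semimagic, symmetric])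
  ultimately show ?thesis
    by (simp add: fps_eq_iff gen_fun_nth decompositions_def)
qed

section \<open>Counting disjoint gaps\<close>

lemma gen_fun_lin2:
  assumes "a > 0" "b > 0"
  shows "gen_fun pos ((*) a) v * gen_fun pos ((*) b) w =
    gen_fun (pos \<times> pos) (\<lambda>(x, y). a * x + b * y) (\<lambda>(x, y). v x * w y)"
  using assms by (intro gen_fun_times fin_fibres_mult)

lemma fin_fibres_lin2:
  assumes "a > 0" "b > 0"
  shows "fin_fibres (pos \<times> pos) (\<lambda>(x, y). a * x + b * y)"
  using assms by (intro fin_fibres_Times fin_fibres_mult)

lemma gen_fun_lin3:
  assumes "a > 0" "b > 0" "c > 0"
  shows "gen_fun pos ((*) a) u * (gen_fun pos ((*) b) v * gen_fun pos ((*) c) w) =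
    gen_fun (pos \<times> pos \<times> pos) (\<lambda>(x, y, z). a * x + b * y + c * z) (\<lambda>(x, y, z). u x * v y * w z)"
  unfolding gen_fun_lin2[OF assms(2,3)]
    gen_fun_times[OF fin_fibres_mult[OF assms(1)] fin_fibres_lin2[OF assms(2,3)]]
  by (auto intro!: gen_fun_cong)

lemma fin_fibres_lin3:
  assumes "a > 0" "b > 0" "c > 0"
  shows "fin_fibres (pos \<times> pos \<times> pos) (\<lambda>(x, y, z). a * x + b * y + c * z)"
proof -
  have "fin_fibres (pos \<times> pos \<times> pos) (\<lambda>(x, y). a * x + (case y of (y, z) \<Rightarrow> b * y + c * z))"
    using assms by (intro fin_fibres_Times fin_fibres_mult fin_fibres_lin2)
  then show ?thesis by (simp add: fin_fibres_def split_def add.assoc)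
qed

section \<open>Counting by symmetry and by the coincidences of excluded values\<close>

definition ordered_gaps :: "((nat \<times> nat) \<times> nat \<times> nat) set" where
  "ordered_gaps = {z \<in> disjoint_gaps. case z of ((p, q), r, s) \<Rightarrow> p + q < r + s}"

text \<open>The sums \<open>p + q\<close> and \<open>r + s\<close> lie in disjoint sets, so they
  differ, and swapping the pairs exchanges the two possible orders.\<close>

lemma gen_fun_disjoint_gaps: "gen_fun disjoint_gaps quad_sum (\<lambda>_. 1) = 2 * gen_fun ordered_gaps quad_sum (\<lambda>_. 1)"
proof -
  let ?h = "\<lambda>((p, q), r, s). ((r, s), p, q)"
  have "disjoint_gaps = ordered_gaps \<union> ?h ` ordered_gaps"
  proof
    show "disjoint_gaps \<subseteq> ordered_gaps \<union> ?h ` ordered_gaps"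
    proof clarify
      fix p q r s
      assume g: "((p, q), r, s) \<in> disjoint_gaps" and n: "((p, q), r, s) \<notin> ?h ` ordered_gaps"
      have "((r, s), p, q) \<notin> ordered_gaps" using n by force
      then show "((p, q), r, s) \<in> ordered_gaps" using g by (auto simp: ordered_gaps_def disjoint_gaps_iff)
    qed
  qed (auto simp: ordered_gaps_def disjoint_gaps_iff)
  moreover have "ordered_gaps \<inter> ?h ` ordered_gaps = {}" by (auto simp: ordered_gaps_def)
  moreover have f: "fin_fibres ordered_gaps quad_sum" "fin_fibres (?h ` ordered_gaps) quad_sum"
    by (rule fin_fibres_subset[OF fin_fibres_disjoint_gaps], force simp: ordered_gaps_def disjoint_gaps_iff)+
  ultimately have "gen_fun disjoint_gaps quad_sum (\<lambda>_. 1) =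
      gen_fun ordered_gaps quad_sum (\<lambda>_. 1) + gen_fun (?h ` ordered_gaps) quad_sum (\<lambda>_. 1)"
    using gen_fun_Un by metis
  also have "gen_fun (?h ` ordered_gaps) quad_sum (\<lambda>_. 1) = gen_fun ordered_gaps quad_sum (\<lambda>_. 1)"
    by (rule gen_fun_reindex[symmetric, of ?h]) (auto simp: bij_betw_def inj_on_def quad_sum_def)
  finally show ?thesis by simp
qed

text \<open>On \<open>ordered_gaps\<close> the subtraction does not truncate, and the third
  component is positive.\<close>

definition gap_profile :: "(nat \<times> nat) \<times> nat \<times> nat \<Rightarrow> nat \<times> nat \<times> nat" where
  "gap_profile = (\<lambda>((p, q), r, s). (p, q, r + s - (p + q)))"

(* With e = p + q + k the excluded values of r are {p, q, p + q} and its reflection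
   {q + k, p + k, k} under r |-> e - r; the sum records their coincidences. *)
lemma card_ordered_gaps_fibre:
  assumes "0 < p" "0 < q" "0 < k"
  shows "real (card {z \<in> ordered_gaps. gap_profile z = (p, q, k)}) =
    real p + real q + real k - 7
    + (if p = q + k then 1 else 0) + (if q = p + k then 1 else 0) + (if k = p + q then 1 else 0)
    + 2 * (if p = k then 1 else 0) + 2 * (if q = k then 1 else 0) + 2 * (if p = q then 1 else 0)
    - 2 * (if p = k \<and> q = k then 1 else 0)"
proof -
  let ?X = "{p, q, p + q, q + k, p + k, k}"
  let ?e = "p + q + k"
  \<comment> \<open>Here \<open>s\<close> is forced to be \<open>?e - r\<close>. As
    \<open>r + s = ?e\<close> exceeds \<open>p\<close>, \<open>q\<close> and \<open>p + q\<close>,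
    only conditions on \<open>r\<close> and on \<open>s\<close> remain, and those on
    \<open>s\<close> are the reflected values in \<open>?X\<close>.\<close>
  have "{z \<in> ordered_gaps. gap_profile z = (p, q, k)} =
      (\<lambda>r. ((p, q), r, ?e - r)) ` ({1..<?e} - ?X)"
  proof
    show "{z \<in> ordered_gaps. gap_profile z = (p, q, k)} \<subseteq>
        (\<lambda>r. ((p, q), r, ?e - r)) ` ({1..<?e} - ?X)"
    proof
      fix z
      assume "z \<in> {z \<in> ordered_gaps. gap_profile z = (p, q, k)}"
      then obtain r s where z: "z = ((p, q), r, s)" and l: "((p, q), r, s) \<in> ordered_gaps"
        and e: "r + s - (p + q) = k"
        by (auto simp: gap_profile_def split: prod.splits)
      then have s: "s = ?e - r" "r < ?e" "0 < r" by (auto simp: ordered_gaps_def disjoint_gaps_iff)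
      then have "r \<notin> ?X" using l e by (auto simp: ordered_gaps_def disjoint_gaps_iff)
      with s show "z \<in> (\<lambda>r. ((p, q), r, ?e - r)) ` ({1..<?e} - ?X)"
        unfolding z by auto
    qed
    show "(\<lambda>r. ((p, q), r, ?e - r)) ` ({1..<?e} - ?X) \<subseteq>
      {z \<in> ordered_gaps. gap_profile z = (p, q, k)}"
      using assms by (auto simp: ordered_gaps_def disjoint_gaps_iff gap_profile_def)
  qed
  then have "card {z \<in> ordered_gaps. gap_profile z = (p, q, k)} =
      card ({1..<?e} - ?X)"
    by (simp add: card_image inj_on_def)
  also have "\<dots> = ?e - 1 - card ?X"
    using assms by (subst card_Diff_subset) auto
  finally have c: "card {z \<in> ordered_gaps. gap_profile z = (p, q, k)} =
      ?e - 1 - card ?X" .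
  \<comment> \<open>This makes the natural subtraction exact, so that it may be passed to the
    reals.\<close>
  have "card ?X \<le> card {1..<?e}" using assms by (intro card_mono) auto
  then have le: "card ?X \<le> ?e - 1" by simp
  \<comment> \<open>An equality such as \<open>p = q + k\<close> merges a value with its own
    reflection and costs one element. One such as \<open>p = k\<close> also merges the reflections,
    here \<open>q + k\<close> and \<open>p + q\<close>, and costs two. For \<open>p = q = k\<close>
    only \<open>p\<close> and \<open>p + p\<close> are left, so four elements are lost and not six,
    whence the correction by 2.\<close>
  have X: "real (card ?X) = 6
      - (if p = q + k then 1 else 0) - (if q = p + k then 1 else 0) - (if k = p + q then 1 else 0)
      - 2 * (if p = k then 1 else 0) - 2 * (if q = k then 1 else 0) - 2 * (if p = q then 1 else 0)
      + 2 * (if p = k \<and> q = k then 1 else 0)"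
  proof -
    consider "p = q" "k = p" | "p = q" "k = p + p" | "p = q" "k \<noteq> p" "k \<noteq> p + p"
      | "p = k" "q = k + k" | "p = k" "q \<noteq> k" "q \<noteq> k + k"
      | "q = k" "p = k + k" | "q = k" "p \<noteq> k" "p \<noteq> k + k"
      | "p \<noteq> q" "p \<noteq> k" "q \<noteq> k" "p = q + k" | "p \<noteq> q" "p \<noteq> k" "q \<noteq> k" "q = p + k"
      | "p \<noteq> q" "p \<noteq> k" "q \<noteq> k" "k = p + q"
      | "p \<noteq> q" "p \<noteq> k" "q \<noteq> k" "p \<noteq> q + k" "q \<noteq> p + k" "k \<noteq> p + q"
      by blast
    then show ?thesis
      using assms by cases (simp_all add: card_insert_if)
  qed
  show ?thesis
    unfolding c using le assms by (simp add: of_nat_diff X)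
qed

lemma gen_fun_ordered_gaps:
  "gen_fun ordered_gaps quad_sum (\<lambda>_. 1) =
    2 * (geo_deriv 2 * (geo 2 * geo 1)) + geo 2 * (geo 2 * geo_deriv 1) - 7 * (geo 2 * (geo 2 * geo 1))
    + 2 * (geo 4 * geo 3) + geo 3 * geo 3 + 4 * (geo 3 * geo 2) + 2 * (geo 4 * geo 1) - 2 * geo 5"
proof -
  let ?P3 = "pos \<times> pos \<times> pos"
  \<comment> \<open>This is \<open>p + q + r + s\<close> expressed through the profile, as
    \<open>r + s = p + q + k\<close>; the factor 1 gives it the shape used in
    \<open>gen_fun_lin3\<close>.\<close>
  let ?s = "\<lambda>(p, q, k). 2 * p + 2 * q + 1 * k :: nat"
  let ?ind = "\<lambda>Q. gen_fun ?P3 ?s (\<lambda>x. if Q x then 1 else 0)"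
  have fs: "fin_fibres ?P3 ?s" by (rule fin_fibres_lin3) auto
  have ff: "fin_fibres ordered_gaps quad_sum"
    by (rule fin_fibres_subset[OF fin_fibres_disjoint_gaps]) (auto simp: ordered_gaps_def)
  \<comment> \<open>Each coincidence cuts out a plane whose positive points are the positive
    combinations of two generators; \<open>a\<close> and \<open>b\<close> are the sizes of these
    generators. For \<open>p = q + k\<close> they are (1,1,0) and (1,0,1), of sizes 4 and 3.\<close>
  have plane: "?ind Q = geo a * geo b"
    if "bij_betw h (pos \<times> pos) {x \<in> ?P3. Q x}" "a > 0" "b > 0"
      "\<And>x y. ?s (h (x, y)) = a * x + b * y" for Q h a b
  proof -
    have "?ind Q = gen_fun {x \<in> ?P3. Q x} ?s (\<lambda>_. 1)"
      by (rule gen_fun_restrict[OF fs])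
    also have "\<dots> = gen_fun (pos \<times> pos) (\<lambda>(x, y). a * x + b * y) (\<lambda>_. 1)"
      by (rule gen_fun_reindex[OF that(1), symmetric]) (use that(4) in auto)
    also have "\<dots> = geo a * geo b"
      using that(2,3) by (simp add: geo_def gen_fun_lin2 case_prod_unfold)
    finally show ?thesis .
  qed
  have I1: "?ind (\<lambda>(p, q, k). p = q + k) = geo 4 * geo 3"
    by (rule plane[of "\<lambda>(x, y). (x + y, x, y)"]) (auto simp: bij_betw_def inj_on_def image_def)
  have I2: "?ind (\<lambda>(p, q, k). q = p + k) = geo 4 * geo 3"
    by (rule plane[of "\<lambda>(x, y). (x, x + y, y)"]) (auto simp: bij_betw_def inj_on_def image_def)
  have I3: "?ind (\<lambda>(p, q, k). k = p + q) = geo 3 * geo 3"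
    by (rule plane[of "\<lambda>(x, y). (x, y, x + y)"]) (auto simp: bij_betw_def inj_on_def image_def)
  have I4: "?ind (\<lambda>(p, q, k). p = k) = geo 3 * geo 2"
    by (rule plane[of "\<lambda>(x, y). (x, y, x)"]) (auto simp: bij_betw_def inj_on_def image_def)
  have I5: "?ind (\<lambda>(p, q, k). q = k) = geo 3 * geo 2"
    by (rule plane[of "\<lambda>(x, y). (y, x, x)"]) (auto simp: bij_betw_def inj_on_def image_def)
  have I6: "?ind (\<lambda>(p, q, k). p = q) = geo 4 * geo 1"
    by (rule plane[of "\<lambda>(x, y). (x, x, y)"]) (auto simp: bij_betw_def inj_on_def image_def)
  have I7: "?ind (\<lambda>(p, q, k). p = k \<and> q = k) = geo 5"
  proof -
    have "?ind (\<lambda>(p, q, k). p = k \<and> q = k) =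
        gen_fun {x \<in> ?P3. case x of (p, q, k) \<Rightarrow> p = k \<and> q = k} ?s (\<lambda>_. 1)"
      by (rule gen_fun_restrict[OF fs])
    also have "\<dots> = geo 5"
      unfolding geo_def
      by (rule gen_fun_reindex[of "\<lambda>x. (x, x, x)", symmetric])
         (auto simp: bij_betw_def inj_on_def image_def)
    finally show ?thesis .
  qed
  have J1: "gen_fun ?P3 ?s (\<lambda>(p, q, k). real p) = geo_deriv 2 * (geo 2 * geo 1)"
    by (simp add: geo_def geo_deriv_def gen_fun_lin3)
  have J2: "gen_fun ?P3 ?s (\<lambda>(p, q, k). real q) = geo 2 * (geo_deriv 2 * geo 1)"
    by (simp add: geo_def geo_deriv_def gen_fun_lin3)
  have J3: "gen_fun ?P3 ?s (\<lambda>(p, q, k). real k) = geo 2 * (geo 2 * geo_deriv 1)"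
    by (simp add: geo_def geo_deriv_def gen_fun_lin3)
  have J4: "gen_fun ?P3 ?s (\<lambda>(p, q, k). 1) = geo 2 * (geo 2 * geo 1)"
    by (simp add: geo_def gen_fun_lin3)
  have "gen_fun ordered_gaps quad_sum (\<lambda>_. 1) = gen_fun ?P3 ?s (\<lambda>y. \<Sum>x | x \<in> ordered_gaps \<and> gap_profile x = y. 1)"
    by (rule gen_fun_fibre[OF ff _ _ fs]) (auto simp: gap_profile_def ordered_gaps_def disjoint_gaps_iff quad_sum_def)
  \<comment> \<open>The cardinality formula is written as a right-nested sum with constants as left
    factors, so that linearity and the evaluations above apply term by term.\<close>
  also have "\<dots> = gen_fun ?P3 ?s (\<lambda>x. (case x of (p, q, k) \<Rightarrow> real p) + ((case x of (p, q, k) \<Rightarrow> real q)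
      + ((case x of (p, q, k) \<Rightarrow> real k) + (-7 * (case x of (p, q, k) \<Rightarrow> 1)
      + ((if case x of (p, q, k) \<Rightarrow> p = q + k then 1 else 0)
      + ((if case x of (p, q, k) \<Rightarrow> q = p + k then 1 else 0)
      + ((if case x of (p, q, k) \<Rightarrow> k = p + q then 1 else 0)
      + (2 * (if case x of (p, q, k) \<Rightarrow> p = k then 1 else 0)
      + (2 * (if case x of (p, q, k) \<Rightarrow> q = k then 1 else 0)
      + (2 * (if case x of (p, q, k) \<Rightarrow> p = q then 1 else 0)
      + (-2) * (if case x of (p, q, k) \<Rightarrow> p = k \<and> q = k then 1 else 0)))))))))))"
    by (rule gen_fun_cong[OF refl]) (auto simp: card_ordered_gaps_fibre)
  also have "\<dots> = geo_deriv 2 * (geo 2 * geo 1) + (geo 2 * (geo_deriv 2 * geo 1)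
      + (geo 2 * (geo 2 * geo_deriv 1) + (fps_const (-7) * (geo 2 * (geo 2 * geo 1))
      + (geo 4 * geo 3 + (geo 4 * geo 3 + (geo 3 * geo 3
      + (fps_const 2 * (geo 3 * geo 2) + (fps_const 2 * (geo 3 * geo 2)
      + (fps_const 2 * (geo 4 * geo 1) + fps_const (-2) * geo 5)))))))))"
    unfolding gen_fun_add gen_fun_cmult I1 I2 I3 I4 I5 I6 I7 J1 J2 J3 J4 ..
  also have "\<dots> = 2 * (geo_deriv 2 * (geo 2 * geo 1)) + geo 2 * (geo 2 * geo_deriv 1)
    - 7 * (geo 2 * (geo 2 * geo 1)) + 2 * (geo 4 * geo 3) + geo 3 * geo 3 + 4 * (geo 3 * geo 2)
    + 2 * (geo 4 * geo 1) - 2 * geo 5"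
  proof -
    have c: "fps_const (- 7) = (- 7 :: real fps)" "fps_const 2 = (2 :: real fps)"
        "fps_const (- 2) = (- 2 :: real fps)"
      by (simp_all add: numeral_fps_const)
    show ?thesis unfolding c by algebra
  qed
  finally show ?thesis .
qed

section \<open>The rational generating function\<close>

text \<open>Over the common denominator (1-x)^4 (1-x^2)^3 (1-x^3)^2 (1-x^4) (1-x^5) of all terms,
  the numerator contains the factor (1-x)^4 (1-x^2); what remains after cancelling it is the stated
  fraction.\<close>

lemma gen_fun_identity:
  fixes x :: "'a::idom"
  shows "2 * (1 - x) * (1 - x ^ 3)\<^sup>2 * (1 - x ^ 4) * (1 - x ^ 5)
      + (1 - x ^ 2) * (1 - x ^ 3)\<^sup>2 * (1 - x ^ 4) * (1 - x ^ 5)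
      - 7 * (1 - x) * (1 - x ^ 2) * (1 - x ^ 3)\<^sup>2 * (1 - x ^ 4) * (1 - x ^ 5)
      + 2 * x ^ 2 * (1 - x)\<^sup>2 * (1 - x ^ 2) ^ 3 * (1 - x ^ 3) * (1 - x ^ 5)
      + x * (1 - x)\<^sup>2 * (1 - x ^ 2) ^ 3 * (1 - x ^ 4) * (1 - x ^ 5)
      + 4 * (1 - x)\<^sup>2 * (1 - x ^ 2)\<^sup>2 * (1 - x ^ 3) * (1 - x ^ 4) * (1 - x ^ 5)
      + 2 * (1 - x) * (1 - x ^ 2) ^ 3 * (1 - x ^ 3)\<^sup>2 * (1 - x ^ 5)
      - 2 * (1 - x)\<^sup>2 * (1 - x ^ 2) ^ 3 * (1 - x ^ 3)\<^sup>2 * (1 - x ^ 4)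
    = x ^ 3 * (18 * x ^ 9 + 46 * x ^ 8 + 69 * x ^ 7 + 74 * x ^ 6 + 65 * x ^ 5
          + 46 * x ^ 4 + 26 * x ^ 3 + 11 * x ^ 2 + 4 * x + 1) * ((1 - x) ^ 4 * (1 - x ^ 2))"
  by algebra

text \<open>Clears denominators with the series kept abstract, so that only their defining relations
  are used. The factor x^7 is the lowest power of x that the terms contribute.\<close>

lemma geometric_combination:
  fixes x d1 d2 d3 d4 d5 g1 g2 g3 g4 g5 e1 e2 :: "'a::idom"
  assumes g: "g1 * d1 = x" "g2 * d2 = x ^ 2" "g3 * d3 = x ^ 3" "g4 * d4 = x ^ 4" "g5 * d5 = x ^ 5"
    and e: "e1 * d1 = g1" "e2 * d2 = g2"
  shows "g1 * g1 * (2 * (e2 * (g2 * g1)) + g2 * (g2 * e1) - 7 * (g2 * (g2 * g1))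
      + 2 * (g4 * g3) + g3 * g3 + 4 * (g3 * g2) + 2 * (g4 * g1) - 2 * g5)
      * (d2\<^sup>2 * d3\<^sup>2 * d4 * d5 * (d1 ^ 4 * d2)) =
    x ^ 7 * (2 * d1 * d3\<^sup>2 * d4 * d5 + d2 * d3\<^sup>2 * d4 * d5 - 7 * d1 * d2 * d3\<^sup>2 * d4 * d5
      + 2 * x ^ 2 * d1\<^sup>2 * d2 ^ 3 * d3 * d5 + x * d1\<^sup>2 * d2 ^ 3 * d4 * d5
      + 4 * d1\<^sup>2 * d2\<^sup>2 * d3 * d4 * d5 + 2 * d1 * d2 ^ 3 * d3\<^sup>2 * d5
      - 2 * d1\<^sup>2 * d2 ^ 3 * d3\<^sup>2 * d4)" (is "?L = ?R")
proof -
  \<comment> \<open>Every \<open>g\<close> is put next to its own \<open>d\<close>, and every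
    \<open>e\<close> next to two factors \<open>d\<close>, so that each group collapses to a power
    of x.\<close>
  have "?L = 2 * ((e2 * d2) * d2) * (g2 * d2) * (g1 * d1) ^ 3 * (d1 * d3\<^sup>2 * d4 * d5)
      + (g2 * d2)\<^sup>2 * ((e1 * d1) * d1) * (g1 * d1)\<^sup>2 * (d2 * d3\<^sup>2 * d4 * d5)
      - 7 * (g2 * d2)\<^sup>2 * (g1 * d1) ^ 3 * (d1 * d2 * d3\<^sup>2 * d4 * d5)
      + 2 * (g4 * d4) * (g3 * d3) * (g1 * d1)\<^sup>2 * (d1\<^sup>2 * d2 ^ 3 * d3 * d5)
      + (g3 * d3)\<^sup>2 * (g1 * d1)\<^sup>2 * (d1\<^sup>2 * d2 ^ 3 * d4 * d5)
      + 4 * (g3 * d3) * (g2 * d2) * (g1 * d1)\<^sup>2 * (d1\<^sup>2 * d2\<^sup>2 * d3 * d4 * d5)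
      + 2 * (g4 * d4) * (g1 * d1) ^ 3 * (d1 * d2 ^ 3 * d3\<^sup>2 * d5)
      - 2 * (g5 * d5) * (g1 * d1)\<^sup>2 * (d1\<^sup>2 * d2 ^ 3 * d3\<^sup>2 * d4)"
    by algebra
  also have "\<dots> = ?R" unfolding e g by algebra
  finally show ?thesis .
qed

abbreviation numerator :: "real fps" where
  "numerator \<equiv> 72 * fps_X ^ 10 *
     (18 * fps_X ^ 9 + 46 * fps_X ^ 8 + 69 * fps_X ^ 7 + 74 * fps_X ^ 6 + 65 * fps_X ^ 5
      + 46 * fps_X ^ 4 + 26 * fps_X ^ 3 + 11 * fps_X ^ 2 + 4 * fps_X + 1)"

abbreviation denominator :: "real fps" where
  "denominator \<equiv> (1 - fps_X ^ 2) ^ 2 * (1 - fps_X ^ 3) ^ 2 * (1 - fps_X ^ 4) * (1 - fps_X ^ 5)"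

lemma fps_S_c_times_denominator: "Abs_fps (\<lambda>t. real (S_c t)) * denominator = numerator"
proof -
  \<comment> \<open>This is the surplus of the common denominator over the stated one; its constant
    coefficient is nonzero, so it can be cancelled at the end.\<close>
  let ?E = "(1 - fps_X) ^ 4 * (1 - fps_X ^ 2) :: real fps"
  have g1: "geo 1 * (1 - fps_X) = fps_X" and e1: "geo_deriv 1 * (1 - fps_X) = geo 1"
    using geo_times[of 1] geo_deriv_times[of 1] by (simp_all only: power_one_right zero_less_one)
  have S: "Abs_fps (\<lambda>t. real (S_c t)) = 72 * (geo 1 * geo 1 * gen_fun ordered_gaps quad_sum (\<lambda>_. 1))"
    unfolding fps_S_c gen_fun_disjoint_gaps by simp
  have "geo 1 * geo 1 * gen_fun ordered_gaps quad_sum (\<lambda>_. 1) * (denominator * ?E) =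
     fps_X ^ 7 * (fps_X ^ 3 * (18 * fps_X ^ 9 + 46 * fps_X ^ 8 + 69 * fps_X ^ 7 + 74 * fps_X ^ 6
      + 65 * fps_X ^ 5 + 46 * fps_X ^ 4 + 26 * fps_X ^ 3 + 11 * fps_X ^ 2 + 4 * fps_X + 1) * ?E)"
    unfolding gen_fun_ordered_gaps gen_fun_identity[symmetric]
    by (rule geometric_combination) (use g1 e1 in \<open>simp_all add: geo_times geo_deriv_times\<close>)
  then have "(Abs_fps (\<lambda>t. real (S_c t)) * denominator) * ?E = numerator * ?E"
    unfolding S by algebra
  moreover have "fps_nth ?E 0 \<noteq> 0"
    by (simp add: fps_power_zeroth)
  then have "?E \<noteq> 0" by (metis fps_zero_nth)
  ultimately show ?thesis by (metis mult_right_cancel)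
qed


section \<open>The closed form\<close>

lemma fps_numeral_mult_nth: "fps_nth (numeral k * f) n = numeral k * fps_nth f n"
  for f :: "'a::comm_ring_1 fps"
  by (simp add: numeral_fps_const)

lemma denominator_expand:
  "denominator = 1 - 2 * fps_X ^ 2 - 2 * fps_X ^ 3 + 3 * fps_X ^ 5 + 3 * fps_X ^ 6 + 2 * fps_X ^ 7
    - fps_X ^ 8 - 4 * fps_X ^ 9 - 4 * fps_X ^ 10 - fps_X ^ 11 + 2 * fps_X ^ 12 + 3 * fps_X ^ 13
    + 3 * fps_X ^ 14 - 2 * fps_X ^ 16 - 2 * fps_X ^ 17 + fps_X ^ 19"
  by algebra

definition c2 :: "nat \<Rightarrow> real" where
  "c2 t = (if even t then 5989/10 else 11933/20)"

definition constituent :: "nat \<Rightarrow> real poly" where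
  "constituent r = [:- c0 r, c1 r, - c2 r, 331/3, -75/8, 3/10:]"

definition closed_form :: "nat \<Rightarrow> real" where
  "closed_form t = poly (constituent (t mod 60)) (real t)"

lemma mod_60:
  "c2 (t mod 60) = c2 t" "c1 (t mod 60) = c1 t" "c0 (t mod 60) = c0 t"
  by (simp_all add: c2_def c1_def c0_def mod_mod_cancel dvd_mod_iff)

lemma closed_form_eq:
  "closed_form t = 3/10 * real t ^ 5 - 75/8 * real t ^ 4 + 331/3 * real t ^ 3
     - c2 t * real t ^ 2 + c1 t * real t - c0 t"
  unfolding closed_form_def constituent_def mod_60 by (simp add: algebra_simps power_numeral_reduce)

(* The coefficients are those of the expanded denominator. *)
definition denom_recurrence :: "(nat \<Rightarrow> real) \<Rightarrow> nat \<Rightarrow> real" where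
  "denom_recurrence f t = f (t + 19) - 2 * f (t + 17) - 2 * f (t + 16) + 3 * f (t + 14) + 3 * f (t + 13)
    + 2 * f (t + 12) - f (t + 11) - 4 * f (t + 10) - 4 * f (t + 9) - f (t + 8) + 2 * f (t + 7)
    + 3 * f (t + 6) + 3 * f (t + 5) - 2 * f (t + 3) - 2 * f (t + 2) + f t"

lemma denom_recurrence_diff: "denom_recurrence (\<lambda>n. f n - g n) t = denom_recurrence f t - denom_recurrence g t"
  by (simp add: denom_recurrence_def)

lemma denom_recurrence_cmult: "denom_recurrence (\<lambda>n. a * f n) t = a * denom_recurrence f t"
  by (simp add: denom_recurrence_def algebra_simps)

text \<open>The denominator vanishes at 1 to order 2 + 2 + 1 + 1 = 6, so the recurrence annihilates
  every polynomial of degree at most 5.\<close>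

lemma denom_recurrence_poly:
  "denom_recurrence (\<lambda>n. 3/10 * (x + real n) ^ 5 - 75/8 * (x + real n) ^ 4 + 331/3 * (x + real n) ^ 3) 0 = 0"
  unfolding denom_recurrence_def by (simp add: field_simps) algebra

(* The poles of the generating function at primitive 5th roots of unity are simple, so c0 is the sum
   of a 5-periodic and a 12-periodic function; this choice makes the first vanish at 0. *)
definition c0_mod_12 :: "nat \<Rightarrow> real" where
  "c0_mod_12 t = [1296, 23465/24, 3824/3, 9315/8, 3544/3, 25705/24, 1296, 25193/24, 3824/3, 8739/8, 3544/3, 27433/24] ! (t mod 12)"

definition c0_mod_5 :: "nat \<Rightarrow> real" where
  "c0_mod_5 t = [0, -288/5, 0, 144/5, 144/5] ! (t mod 5)"

lemma c0_table_split:
  "c0_table = map (\<lambda>r. map (\<lambda>k. c0_mod_12 r + c0_mod_5 (r + 12 * k)) [0..<5]) [0..<12]"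
proof -
  have "[0..<5] = [0, 1, 2, 3, 4]" "[0..<12] = [0, 1, 2, 3, 4, 5, 6, 7, 8, 9, 10, 11]"
    by (simp_all add: upt_rec)
  then show ?thesis
    by (simp add: c0_table_def c0_mod_12_def c0_mod_5_def)
qed

lemma c0_split: "c0 t = c0_mod_12 t + c0_mod_5 t"
proof -
  have "c0 t = c0_mod_12 (t mod 12) + c0_mod_5 (t mod 12 + 12 * (t mod 60 div 12))"
    unfolding c0_def c0_table_split by (subst nth_map; simp add: less_mult_imp_div_less)+
  moreover have "t mod 12 + 12 * (t mod 60 div 12) = t mod 60"
    using mult_div_mod_eq[of 12 "t mod 60"] mod_mod_cancel[of 12 60 t] by simp
  moreover have "c0_mod_5 (t mod 60) = c0_mod_5 t"
    using mod_mod_cancel[of 5 60 t] by (simp add: c0_mod_5_def)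
  ultimately show ?thesis by (simp add: c0_mod_12_def)
qed

text \<open>Up to sign these are the coefficients of x^2, x and 1 when the quadratic part of
  \<open>closed_form (t + n)\<close>, without \<open>c0_mod_5\<close>, is expanded in x =
  \<open>real t\<close>. They depend on \<open>t\<close> only through \<open>r\<close>, so twelve
  evaluations suffice.\<close>

lemma denom_recurrence_periodic_12:
  assumes "r < 12"
  shows "denom_recurrence (\<lambda>n. c2 (r + n)) 0 = 0"
    and "denom_recurrence (\<lambda>n. 2 * real n * c2 (r + n) - c1 (r + n)) 0 = 0"
    and "denom_recurrence (\<lambda>n. real n ^ 2 * c2 (r + n) - real n * c1 (r + n) + c0_mod_12 (r + n)) 0 = 0"
proof -
  have "r \<in> {0, 1, 2, 3, 4, 5, 6, 7, 8, 9, 10, 11}"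
    using assms by simp presburger
  then show "denom_recurrence (\<lambda>n. c2 (r + n)) 0 = 0"
    "denom_recurrence (\<lambda>n. 2 * real n * c2 (r + n) - c1 (r + n)) 0 = 0"
    "denom_recurrence (\<lambda>n. real n ^ 2 * c2 (r + n) - real n * c1 (r + n) + c0_mod_12 (r + n)) 0 = 0"
    by (elim insertE emptyE; simp add: denom_recurrence_def c2_def c1_def c0_mod_12_def)+
qed

lemma denom_recurrence_periodic_5:
  assumes "r < 5"
  shows "denom_recurrence (\<lambda>n. c0_mod_5 (r + n)) 0 = 0"
proof -
  have "r \<in> {0, 1, 2, 3, 4}"
    using assms by auto
  then show ?thesis
    by (elim insertE emptyE; simp add: denom_recurrence_def c0_mod_5_def)
qed

lemma denom_recurrence_closed_form: "denom_recurrence closed_form t = 0"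
proof -
  let ?x = "real t"
  let ?r = "t mod 12"
  \<comment> \<open>In the periodic coefficients \<open>t\<close> is replaced by its residue, while
    in the powers \<open>?x\<close> stays a free variable; the claim thus splits into one polynomial
    identity and finitely many numerical ones.\<close>
  have m: "c2 (t + n) = c2 (?r + n)" "c1 (t + n) = c1 (?r + n)"
    "c0_mod_12 (t + n) = c0_mod_12 (?r + n)" "c0_mod_5 (t + n) = c0_mod_5 (t mod 5 + n)" for n
  proof -
    have "(t + n) mod 12 = (?r + n) mod 12" by (simp add: mod_add_left_eq)
    then have "(t + n) mod 2 = (?r + n) mod 2" "(t + n) mod 6 = (?r + n) mod 6"
      using mod_mod_cancel[of 2 12 "t + n"] mod_mod_cancel[of 2 12 "?r + n"]
        mod_mod_cancel[of 6 12 "t + n"] mod_mod_cancel[of 6 12 "?r + n"] by simp_all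
    then show "c2 (t + n) = c2 (?r + n)" "c1 (t + n) = c1 (?r + n)"
      unfolding c2_def c1_def even_iff_mod_2_eq_zero by simp_all
  qed (simp_all add: c0_mod_12_def c0_mod_5_def mod_add_left_eq)
  have "denom_recurrence closed_form t = denom_recurrence (\<lambda>n. closed_form (t + n)) 0"
    by (simp add: denom_recurrence_def add.commute)
  also have "\<dots> = denom_recurrence (\<lambda>n. 3/10 * (?x + real n) ^ 5 - 75/8 * (?x + real n) ^ 4 + 331/3 * (?x + real n) ^ 3) 0
    - ?x ^ 2 * denom_recurrence (\<lambda>n. c2 (?r + n)) 0
    - ?x * denom_recurrence (\<lambda>n. 2 * real n * c2 (?r + n) - c1 (?r + n)) 0
    - denom_recurrence (\<lambda>n. real n ^ 2 * c2 (?r + n) - real n * c1 (?r + n) + c0_mod_12 (?r + n)) 0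
    - denom_recurrence (\<lambda>n. c0_mod_5 (t mod 5 + n)) 0"
  proof -
    have "closed_form (t + n) = (3/10 * (?x + real n) ^ 5 - 75/8 * (?x + real n) ^ 4 + 331/3 * (?x + real n) ^ 3)
      - ?x ^ 2 * c2 (?r + n)
      - ?x * (2 * real n * c2 (?r + n) - c1 (?r + n))
      - (real n ^ 2 * c2 (?r + n) - real n * c1 (?r + n) + c0_mod_12 (?r + n))
      - c0_mod_5 (t mod 5 + n)" for n
      unfolding closed_form_eq c0_split m of_nat_add by algebra
    then show ?thesis
      by (simp only: denom_recurrence_diff[symmetric] denom_recurrence_cmult[symmetric])
  qed
  also have "\<dots> = 0"
    using denom_recurrence_periodic_12[of ?r] denom_recurrence_periodic_5[of "t mod 5"] denom_recurrence_poly
    by simp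
  finally show ?thesis .
qed

text \<open>The recurrence has order 19, so these are starting values for it.\<close>

lemma closed_form_values:
  "closed_form 1 = 0" "closed_form 2 = 0" "closed_form 3 = 0" "closed_form 4 = 0" "closed_form 5 = 0"
  "closed_form 6 = 0" "closed_form 7 = 0" "closed_form 8 = 0" "closed_form 9 = 0" "closed_form 10 = 72"
  "closed_form 11 = 288" "closed_form 12 = 936" "closed_form 13 = 2592" "closed_form 14 = 5760" "closed_form 15 = 11520"
  "closed_form 16 = 20952" "closed_form 17 = 35712" "closed_form 18 = 57168" "closed_form 19 = 88272"
  by (simp_all add: closed_form_eq c2_def c1_def c0_split c0_mod_12_def c0_mod_5_def)

lemma fps_closed_form_times_denominator:
  "Abs_fps (\<lambda>t. if t > 0 then closed_form t else 0) * denominator = numerator"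
proof (rule fps_ext)
  fix n
  let ?A = "Abs_fps (\<lambda>t. if t > 0 then closed_form t else 0)"
  let ?f = "\<lambda>k. if k < n then closed_form (n - k) else 0"
  have nth: "fps_nth (?A * fps_X ^ k) n = ?f k" for k
    by (simp add: fps_X_power_mult_right_nth)
  have lhs: "fps_nth (?A * denominator) n = ?f 0 - 2 * ?f 2 - 2 * ?f 3 + 3 * ?f 5 + 3 * ?f 6 + 2 * ?f 7
    - ?f 8 - 4 * ?f 9 - 4 * ?f 10 - ?f 11 + 2 * ?f 12 + 3 * ?f 13 + 3 * ?f 14 - 2 * ?f 16 - 2 * ?f 17
    + ?f 19"
  proof -
    have "?A * denominator = ?A * fps_X ^ 0 - 2 * (?A * fps_X ^ 2) - 2 * (?A * fps_X ^ 3)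
      + 3 * (?A * fps_X ^ 5) + 3 * (?A * fps_X ^ 6) + 2 * (?A * fps_X ^ 7)
      - ?A * fps_X ^ 8 - 4 * (?A * fps_X ^ 9) - 4 * (?A * fps_X ^ 10) - ?A * fps_X ^ 11
      + 2 * (?A * fps_X ^ 12) + 3 * (?A * fps_X ^ 13) + 3 * (?A * fps_X ^ 14)
      - 2 * (?A * fps_X ^ 16) - 2 * (?A * fps_X ^ 17) + ?A * fps_X ^ 19"
      unfolding denominator_expand by algebra
    then show ?thesis
      by (simp only: fps_add_nth fps_sub_nth fps_numeral_mult_nth nth)
  qed
  have rhs: "fps_nth numerator n = (if n = 10 then 72 else if n = 11 then 288 else if n = 12 then 792
    else if n = 13 then 1872 else if n = 14 then 3312 else if n = 15 then 4680 else if n = 16 then 5328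
    else if n = 17 then 4968 else if n = 18 then 3312 else if n = 19 then 1296 else 0)"
  proof -
    have "numerator = 1296 * fps_X ^ 19 + 3312 * fps_X ^ 18 + 4968 * fps_X ^ 17 + 5328 * fps_X ^ 16
      + 4680 * fps_X ^ 15 + 3312 * fps_X ^ 14 + 1872 * fps_X ^ 13 + 792 * fps_X ^ 12
      + 288 * fps_X ^ 11 + 72 * fps_X ^ 10"
      by algebra
    then show ?thesis
      by (simp only: fps_add_nth fps_numeral_mult_nth fps_X_power_nth) simp
  qed
  show "fps_nth (?A * denominator) n = fps_nth numerator n"
  \<comment> \<open>From \<open>n = 20\<close> on, all arguments from \<open>n - 19\<close> to
    \<open>n\<close> are positive and the coefficient is the recurrence at \<open>n - 19\<close>. At
    \<open>n = 19\<close> the cut-off at 0 drops \<open>closed_form 0 = -1296\<close>, which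
    produces the top coefficient 1296 of the numerator.\<close>
  proof (cases "n < 20")
    case True
    then have "n \<in> {0, 1, 2, 3, 4, 5, 6, 7, 8, 9, 10, 11, 12, 13, 14, 15, 16, 17, 18, 19}"
      by simp presburger
    then show ?thesis
      unfolding lhs rhs
      by (elim insertE emptyE; simp add: closed_form_values closed_form_values(1)[unfolded One_nat_def])
  next
    case False
    then obtain m where n: "n = m + 20" by (metis add.commute le_Suc_ex not_less)
    have "fps_nth (?A * denominator) n = denom_recurrence closed_form (m + 1)"
      unfolding lhs unfolding denom_recurrence_def n by (simp add: algebra_simps Suc3_eq_add_3)
    moreover have "fps_nth numerator n = 0"
      unfolding rhs using n by simp
    ultimately show ?thesis by (simp only: denom_recurrence_closed_form)
  qed
qed

section \<open>Identification of the count with the closed form\<close>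

lemma S_c_0: "S_c 0 = 0"
proof -
  have n: "\<not> (\<forall>i j. 0 < M $ i $ j \<and> M $ i $ j < int 0)" for M :: "int ^ 3 ^ 3"
  proof
    assume "\<forall>i j. 0 < M $ i $ j \<and> M $ i $ j < int 0"
    from this[rule_format, of 1 1] show False by auto
  qed
  show ?thesis unfolding S_c_def by (simp only: n simp_thms Collect_const if_False card.empty)
qed

lemma denominator_nonzero: "denominator \<noteq> 0"
proof -
  have "fps_nth denominator 0 \<noteq> 0" by (simp add: fps_power_zeroth)
  then show ?thesis by (metis fps_zero_nth)
qed

text \<open>Both series have the same product with the nonzero \<open>denominator\<close>, and real
  power series form an integral domain.\<close>

lemma S_c_closed_form:
  assumes "t > 0"
  shows "real (S_c t) = closed_form t"
proof -
  have "Abs_fps (\<lambda>t. real (S_c t)) * denominator =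
      Abs_fps (\<lambda>t. if t > 0 then closed_form t else 0) * denominator"
    by (simp only: fps_S_c_times_denominator fps_closed_form_times_denominator)
  then have "Abs_fps (\<lambda>t. real (S_c t)) = Abs_fps (\<lambda>t. if t > 0 then closed_form t else 0)"
    by (simp only: mult_right_cancel[OF denominator_nonzero])
  then have "fps_nth (Abs_fps (\<lambda>t. real (S_c t))) t =
      fps_nth (Abs_fps (\<lambda>t. if t > 0 then closed_form t else 0)) t"
    by simp
  with assms show ?thesis by simp
qed


section \<open>Period and constituents\<close>

(* Both polynomials agree with N on the infinite class of t modulo p * q. *)
lemma constituents_unique:
  fixes N :: "nat \<Rightarrow> real"
  assumes "has_constituents N p C" "has_constituents N q D"
  shows "C (t mod p) = D (t mod q)"
proof -
  have pq: "p > 0" "q > 0" using assms by (auto simp: has_constituents_def)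
  \<comment> \<open>\<open>Suc k\<close> keeps the argument positive even for \<open>t = 0\<close>,
    where \<open>has_constituents\<close> says nothing.\<close>
  let ?f = "\<lambda>k. real (t + p * q * Suc k)"
  have "poly (C (t mod p) - D (t mod q)) (?f k) = 0" for k
  proof -
    have "t + p * q * Suc k > 0" using pq by simp
    moreover have "(t + p * q * Suc k) mod p = t mod p"
      by (simp only: mult.assoc mod_mult_self2)
    moreover have "(t + p * q * Suc k) mod q = t mod q"
      by (simp only: mult.assoc mult.left_commute[of p] mod_mult_self2)
    ultimately show ?thesis
      using assms unfolding has_constituents_def by (metis diff_self poly_diff)
  qed
  then have "range ?f \<subseteq> {x. poly (C (t mod p) - D (t mod q)) x = 0}" by auto
  moreover have "infinite (range ?f)"
    using pq by (intro range_inj_infinite) (auto simp: inj_def)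
  ultimately have "infinite {x. poly (C (t mod p) - D (t mod q)) x = 0}"
    using finite_subset by blast
  then show ?thesis using poly_roots_finite[of "C (t mod p) - D (t mod q)"] by auto
qed

lemma has_constituents_S_c: "has_constituents (\<lambda>t. real (S_c t)) 60 constituent"
  by (simp add: has_constituents_def S_c_closed_form closed_form_def)

lemma c0_shift_neq:
  assumes "0 < p" "p < 60"
  shows "c0 p \<noteq> c0 0 \<or> c0 (Suc p mod 60) \<noteq> c0 1"
proof -
  have "p \<in> set [1..<60]" using assms by simp
  \<comment> \<open>The numbers 1296 and 110413/120 are \<open>c0 0\<close> and \<open>c0 1\<close>;
    all 59 shifts are decided by evaluation.\<close>
  moreover have "list_all (\<lambda>p. c0_table ! (p mod 12) ! (p mod 60 div 12) \<noteq> 1296 \<or>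
    c0_table ! (Suc p mod 60 mod 12) ! (Suc p mod 60 mod 60 div 12) \<noteq> 110413/120) [1..<60]"
    unfolding c0_table_def by code_simp
  ultimately show ?thesis
    unfolding list_all_iff by (auto simp: c0_def c0_table_def)
qed

text \<open>By uniqueness of constituents, a smaller \<open>p\<close> would be a period of the
  constituents modulo 60, hence of their constant terms \<open>- c0\<close>, which the table
  refutes.\<close>

lemma quasi_period_S_c: "quasi_period (\<lambda>t. real (S_c t)) = 60"
  unfolding quasi_period_def
proof (rule Least_equality)
  show "\<exists>C. has_constituents (\<lambda>t. real (S_c t)) 60 C"
    using has_constituents_S_c by blast
next
  fix p assume "\<exists>C. has_constituents (\<lambda>t. real (S_c t)) p C"
  then obtain C where C: "has_constituents (\<lambda>t. real (S_c t)) p C" by blast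
  show "60 \<le> p"
  proof (rule ccontr)
    assume "\<not> 60 \<le> p"
    then have p: "0 < p" "p < 60" using C by (auto simp: has_constituents_def)
    \<comment> \<open>Both sides equal \<open>C (t mod p)\<close>, because \<open>t\<close> and
      \<open>t + p\<close> have the same residue modulo \<open>p\<close>.\<close>
    have eq: "constituent (t mod 60) = constituent ((t + p) mod 60)" for t
      using constituents_unique[OF C has_constituents_S_c, of t]
        constituents_unique[OF C has_constituents_S_c, of "t + p"] by simp
    have "c0 p = c0 0" "c0 (Suc p mod 60) = c0 1"
      using eq[of 0] eq[of 1] p by (simp_all add: constituent_def)
    then show False using c0_shift_neq[OF p] by simp
  qed
qed

lemma principal_constituent_S_c: "principal_constituent (\<lambda>t. real (S_c t)) = constituent 0"
  unfolding principal_constituent_def quasi_period_S_c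
proof (rule the_equality)
  show "\<exists>C. has_constituents (\<lambda>t. real (S_c t)) 60 C \<and> constituent 0 = C 0"
    using has_constituents_S_c by blast
next
  fix q assume "\<exists>C. has_constituents (\<lambda>t. real (S_c t)) 60 C \<and> q = C 0"
  then show "q = constituent 0"
    using constituents_unique[OF _ has_constituents_S_c, where t = 0] by auto
qed

lemma constituent_0: "constituent 0 = [:-1296, 1464, -5989/10, 331/3, -75/8, 3/10:]"
  by (simp add: constituent_def c0_def c0_table_def c1_def c2_def)

theorem mainTheorem3:
  shows "(Abs_fps (\<lambda>t. if t > 0 then real (S_c t) else 0) =
       72 * fps_X ^ 10 *
         (18 * fps_X ^ 9 + 46 * fps_X ^ 8 + 69 * fps_X ^ 7 + 74 * fps_X ^ 6 + 65 * fps_X ^ 5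
          + 46 * fps_X ^ 4 + 26 * fps_X ^ 3 + 11 * fps_X ^ 2 + 4 * fps_X + 1)
       / ((1 - fps_X ^ 2) ^ 2 * (1 - fps_X ^ 3) ^ 2 * (1 - fps_X ^ 4) * (1 - fps_X ^ 5)))
    \<and> (\<forall>t\<ge>1. real (S_c t) =
       (if even t
        then 3/10 * real t ^ 5 - 75/8 * real t ^ 4 + 331/3 * real t ^ 3
             - 5989/10 * real t ^ 2 + c1 t * real t - c0 t
        else 3/10 * real t ^ 5 - 75/8 * real t ^ 4 + 331/3 * real t ^ 3
             - 11933/20 * real t ^ 2 + c1 t * real t - c0 t))
    \<and> quasipolynomial (\<lambda>t. real (S_c t))
    \<and> quasi_period (\<lambda>t. real (S_c t)) = 60
    \<and> principal_constituent (\<lambda>t. real (S_c t)) =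
       [:-1296, 1464, -5989/10, 331/3, -75/8, 3/10:]"
proof (intro conjI allI impI)
  \<comment> \<open>No integer lies strictly between 0 and 0, so the count at 0 agrees with the
    value 0 of the cut-off series.\<close>
  have "Abs_fps (\<lambda>t. if t > 0 then real (S_c t) else 0) = Abs_fps (\<lambda>t. real (S_c t))"
    by (rule fps_ext) (simp add: S_c_0)
  also have "\<dots> = numerator / denominator"
    unfolding fps_S_c_times_denominator[symmetric]
    using denominator_nonzero by (rule nonzero_mult_div_cancel_right[symmetric])
  finally show "Abs_fps (\<lambda>t. if t > 0 then real (S_c t) else 0) = numerator / denominator" .
next
  fix t :: nat
  assume "t \<ge> 1"
  then show "real (S_c t) =
       (if even t
        then 3/10 * real t ^ 5 - 75/8 * real t ^ 4 + 331/3 * real t ^ 3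
             - 5989/10 * real t ^ 2 + c1 t * real t - c0 t
        else 3/10 * real t ^ 5 - 75/8 * real t ^ 4 + 331/3 * real t ^ 3
             - 11933/20 * real t ^ 2 + c1 t * real t - c0 t)"
    by (simp add: S_c_closed_form closed_form_eq c2_def)
next
  show "quasipolynomial (\<lambda>t. real (S_c t))"
    unfolding quasipolynomial_def using has_constituents_S_c by blast
  show "quasi_period (\<lambda>t. real (S_c t)) = 60"
    by (rule quasi_period_S_c)
  show "principal_constituent (\<lambda>t. real (S_c t)) = [:-1296, 1464, -5989/10, 331/3, -75/8, 3/10:]"
    unfolding principal_constituent_S_c by (rule constituent_0)
qed

end
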